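(* Let $(R,P_\Omega)$ be a multiple Rota-Baxter algebra of pair weight $(\lambda_\Omega,\lambda_\Omega)$, let $(M,\mathfrak{m}_\Omega)$ be a right $(R,P_\Omega)$-module and $(N,\mathfrak{n}_\Omega)$ a left $(R,P_\Omega)$-module. Let $G$ be the free abelian group generated by the set $M\times N$, and let $I$ be the subgroup of $G$ generated by all elements of the form $$(m_1+m_2,n)-(m_1,n)-(m_2,n),\quad (m,n_1+n_2)-(m,n_1)-(m,n_2),$$ $$(mr,n)-(m,rn),\quad (\mathfrak{m}_\omega(m),n)-(m,\mathfrak{n}_\omega(n)),$$ for $m,m_1,m_2\in M$, $n,n_1,n_2\in N$, $r\in R$, $\omega\in\Omega$. Then the quotient group $G/I$, equipped with the canonical map $\zeta:M\times N\to G\to G/I$, is the tensor product $M\otimes_{(R,P_\Omega)}N$.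
   Context: $\mathbf{k}$ is a commutative unital ring; algebras are associative unital $\mathbf{k}$-algebras, modules are unital, "linear" means $\mathbf{k}$-linear. $\Omega$ is a nonempty set and $\lambda_\Omega=(\lambda_\omega)_{\omega\in\Omega}$ a family of elements of $\mathbf{k}$. A multiple Rota-Baxter algebra $(R,P_\Omega)$ of pair weight $(\lambda_\Omega,\lambda_\Omega)$ is an algebra $R$ with linear operators $P_\omega:R\to R$ ($\omega\in\Omega$) such that $P_\alpha(r)P_\beta(s)=P_\alpha(rP_\beta(s))+P_\beta(P_\alpha(r)s)+\lambda_\beta P_\alpha(rs)+\lambda_\alpha P_\beta(rs)$ for all $r,s\in R$, $\alpha,\beta\in\Omega$. A left $(R,P_\Omega)$-module $(N,\mathfrak{n}_\Omega)$ is a left $R$-module $N$ with linear operators $\mathfrak{n}_\omega:N\to N$ such that $P_\alpha(r)\mathfrak{n}_\beta(n)=\mathfrak{n}_\alpha(r\mathfrak{n}_\beta(n))+\mathfrak{n}_\beta(P_\alpha(r)n)+\lambda_\beta\mathfrak{n}_\alpha(rn)+\lambda_\alpha\mathfrak{n}_\beta(rn)$ for all $r\in R,n\in N,\alpha,\beta\in\Omega$. A right $(R,P_\Omega)$-module $(M,\mathfrak{m}_\Omega)$ is a right $R$-module $M$ with linear operators $\mathfrak{m}_\omega:M\to M$ such that $\mathfrak{m}_\beta(mP_\alpha(r))=\mathfrak{m}_\beta(\mathfrak{m}_\alpha(m)r)+\mathfrak{m}_\beta(m)P_\alpha(r)+\lambda_\beta\mathfrak{m}_\alpha(m)r+\lambda_\alpha\mathfrak{m}_\beta(m)r$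 for all $r\in R,m\in M,\alpha,\beta\in\Omega$. For an abelian group $A$, a map $\varphi:M\times N\to A$ is $(R,P_\Omega)$-bilinear if it is additive in each variable, $\varphi(mr,n)=\varphi(m,rn)$ and $\varphi(\mathfrak{m}_\omega(m),n)=\varphi(m,\mathfrak{n}_\omega(n))$ for all $m\in M,n\in N,r\in R,\omega\in\Omega$. The tensor product $M\otimes_{(R,P_\Omega)}N$ is an abelian group with an $(R,P_\Omega)$-bilinear map $\zeta:M\times N\to M\otimes_{(R,P_\Omega)}N$ such that for every abelian group $A$ and $(R,P_\Omega)$-bilinear map $\varphi:M\times N\to A$ there is a unique group homomorphism $\widetilde\varphi:M\otimes_{(R,P_\Omega)}N\to A$ with $\varphi=\widetilde\varphi\circ\zeta$. *)

theory Defs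
  imports "HOL-Algebra.Algebra"
begin

section \<open>Algebras and one-sided modules\<close>

text \<open>
  The library's \<^locale>\<open>algebra\<close> is commutative and its \<^locale>\<open>module\<close> has a commutative base ring.
  The locales below do without commutativity. As for \<^locale>\<open>module\<close>, only the additive part of
  the ring record underlying a module is meaningful.
\<close>

locale assoc_algebra = module K R + ring R
  for K :: "('k, 'x) ring_scheme" and R :: "('k, 'r, 'y) module_scheme" +
  assumes smult_mult_left:
      "\<lbrakk>c \<in> carrier K; r \<in> carrier R; s \<in> carrier R\<rbrakk> \<Longrightarrow>
       (c \<odot>\<^bsub>R\<^esub> r) \<otimes>\<^bsub>R\<^esub> s = c \<odot>\<^bsub>R\<^esub> (r \<otimes>\<^bsub>R\<^esub> s)"
    and smult_mult_right:
      "\<lbrakk>c \<in> carrier K; r \<in> carrier R; s \<in> carrier R\<rbrakk> \<Longrightarrow>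
       r \<otimes>\<^bsub>R\<^esub> (c \<odot>\<^bsub>R\<^esub> s) = c \<odot>\<^bsub>R\<^esub> (r \<otimes>\<^bsub>R\<^esub> s)"

locale left_module = R?: ring R + N?: abelian_group N
  for R :: "('r, 'x) ring_scheme" and N :: "('r, 'n, 'y) module_scheme" +
  assumes lsmult_closed:
      "\<lbrakk>r \<in> carrier R; n \<in> carrier N\<rbrakk> \<Longrightarrow> r \<odot>\<^bsub>N\<^esub> n \<in> carrier N"
    and lsmult_add_scalar:
      "\<lbrakk>r \<in> carrier R; s \<in> carrier R; n \<in> carrier N\<rbrakk> \<Longrightarrow>
       (r \<oplus>\<^bsub>R\<^esub> s) \<odot>\<^bsub>N\<^esub> n = r \<odot>\<^bsub>N\<^esub> n \<oplus>\<^bsub>N\<^esub> s \<odot>\<^bsub>N\<^esub> n"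
    and lsmult_add_vector:
      "\<lbrakk>r \<in> carrier R; n \<in> carrier N; n' \<in> carrier N\<rbrakk> \<Longrightarrow>
       r \<odot>\<^bsub>N\<^esub> (n \<oplus>\<^bsub>N\<^esub> n') = r \<odot>\<^bsub>N\<^esub> n \<oplus>\<^bsub>N\<^esub> r \<odot>\<^bsub>N\<^esub> n'"
    and lsmult_assoc:
      "\<lbrakk>r \<in> carrier R; s \<in> carrier R; n \<in> carrier N\<rbrakk> \<Longrightarrow>
       (r \<otimes>\<^bsub>R\<^esub> s) \<odot>\<^bsub>N\<^esub> n = r \<odot>\<^bsub>N\<^esub> (s \<odot>\<^bsub>N\<^esub> n)"
    and lsmult_one:
      "n \<in> carrier N \<Longrightarrow> \<one>\<^bsub>R\<^esub> \<odot>\<^bsub>N\<^esub> n = n"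

record ('r, 'm) right_module_rec = "'m ring" +
  rsmult :: "'m \<Rightarrow> 'r \<Rightarrow> 'm" (infixl \<open>\<bullet>\<index>\<close> 70)

locale right_module = R?: ring R + M?: abelian_group M
  for R :: "('r, 'x) ring_scheme" and M :: "('r, 'm, 'y) right_module_rec_scheme" +
  assumes rsmult_closed:
      "\<lbrakk>m \<in> carrier M; r \<in> carrier R\<rbrakk> \<Longrightarrow> m \<bullet>\<^bsub>M\<^esub> r \<in> carrier M"
    and rsmult_add_scalar:
      "\<lbrakk>m \<in> carrier M; r \<in> carrier R; s \<in> carrier R\<rbrakk> \<Longrightarrow>
       m \<bullet>\<^bsub>M\<^esub> (r \<oplus>\<^bsub>R\<^esub> s) = m \<bullet>\<^bsub>M\<^esub> r \<oplus>\<^bsub>M\<^esub> m \<bullet>\<^bsub>M\<^esub> s"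
    and rsmult_add_vector:
      "\<lbrakk>m \<in> carrier M; m' \<in> carrier M; r \<in> carrier R\<rbrakk> \<Longrightarrow>
       (m \<oplus>\<^bsub>M\<^esub> m') \<bullet>\<^bsub>M\<^esub> r = m \<bullet>\<^bsub>M\<^esub> r \<oplus>\<^bsub>M\<^esub> m' \<bullet>\<^bsub>M\<^esub> r"
    and rsmult_assoc:
      "\<lbrakk>m \<in> carrier M; r \<in> carrier R; s \<in> carrier R\<rbrakk> \<Longrightarrow>
       m \<bullet>\<^bsub>M\<^esub> (r \<otimes>\<^bsub>R\<^esub> s) = (m \<bullet>\<^bsub>M\<^esub> r) \<bullet>\<^bsub>M\<^esub> s"
    and rsmult_one:
      "m \<in> carrier M \<Longrightarrow> m \<bullet>\<^bsub>M\<^esub> \<one>\<^bsub>R\<^esub> = m"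

text \<open>
  A one-sided module over a \<open>K\<close>-algebra \<open>R\<close> is a \<open>K\<close>-module through \<open>K \<rightarrow> R\<close>, \<open>c \<mapsto> c 1\<close>. Since
  modules are unital, this is the only \<open>K\<close>-module structure compatible with the \<open>R\<close>-action.
\<close>

definition left_scalars ::
  "('k, 'r, 'y) module_scheme \<Rightarrow> ('r, 'n, 'z) module_scheme \<Rightarrow> ('k, 'n) module" where
  "left_scalars R N =
     \<lparr>carrier = carrier N, monoid.mult = monoid.mult N, one = \<one>\<^bsub>N\<^esub>,
      ring.zero = \<zero>\<^bsub>N\<^esub>, ring.add = ring.add N, smult = (\<lambda>c n. (c \<odot>\<^bsub>R\<^esub> \<one>\<^bsub>R\<^esub>) \<odot>\<^bsub>N\<^esub> n)\<rparr>"

definition right_scalars ::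
  "('k, 'r, 'y) module_scheme \<Rightarrow> ('r, 'm, 'z) right_module_rec_scheme \<Rightarrow> ('k, 'm) module" where
  "right_scalars R M =
     \<lparr>carrier = carrier M, monoid.mult = monoid.mult M, one = \<one>\<^bsub>M\<^esub>,
      ring.zero = \<zero>\<^bsub>M\<^esub>, ring.add = ring.add M, smult = (\<lambda>c m. m \<bullet>\<^bsub>M\<^esub> (c \<odot>\<^bsub>R\<^esub> \<one>\<^bsub>R\<^esub>))\<rparr>"

lemma module_left_scalars:
  assumes "assoc_algebra K R" and "left_module R N"
  shows "module K (left_scalars R N)"
proof -
  interpret A: assoc_algebra K R by fact
  interpret N: left_module R N by fact
  have eq: "(a \<otimes>\<^bsub>K\<^esub> b) \<odot>\<^bsub>R\<^esub> \<one>\<^bsub>R\<^esub> = (a \<odot>\<^bsub>R\<^esub> \<one>\<^bsub>R\<^esub>) \<otimes>\<^bsub>R\<^esub> (b \<odot>\<^bsub>R\<^esub> \<one>\<^bsub>R\<^esub>)"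
    if "a \<in> carrier K" "b \<in> carrier K" for a b
    using that by (simp add: A.smult_mult_left A.smult_assoc1)
  show ?thesis
  proof (rule moduleI)
    show "abelian_group (left_scalars R N)"
      by (rule abelian_groupI)
        (auto simp: left_scalars_def N.N.a_assoc intro: N.N.a_comm N.N.l_neg N.N.a_inv_closed)
  qed (auto simp: left_scalars_def A.R.is_cring N.lsmult_closed N.lsmult_add_vector
      N.lsmult_assoc N.lsmult_one A.smult_l_distr N.lsmult_add_scalar eq)
qed

lemma module_right_scalars:
  assumes "assoc_algebra K R" and "right_module R M"
  shows "module K (right_scalars R M)"
proof -
  interpret A: assoc_algebra K R by fact
  interpret M: right_module R M by fact
  have eq: "(a \<otimes>\<^bsub>K\<^esub> b) \<odot>\<^bsub>R\<^esub> \<one>\<^bsub>R\<^esub> = (b \<odot>\<^bsub>R\<^esub> \<one>\<^bsub>R\<^esub>) \<otimes>\<^bsub>R\<^esub> (a \<odot>\<^bsub>R\<^esub> \<one>\<^bsub>R\<^esub>)"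
    if "a \<in> carrier K" "b \<in> carrier K" for a b
    using that by (simp add: A.smult_mult_right A.smult_assoc1)
  show ?thesis
  proof (rule moduleI)
    show "abelian_group (right_scalars R M)"
      by (rule abelian_groupI)
        (auto simp: right_scalars_def M.M.a_assoc intro: M.M.a_comm M.M.l_neg M.M.a_inv_closed)
  qed (auto simp: right_scalars_def A.R.is_cring M.rsmult_closed M.rsmult_add_vector
      M.rsmult_assoc M.rsmult_one A.smult_l_distr M.rsmult_add_scalar eq)
qed

definition linear_operator ::
  "('k, 'x) ring_scheme \<Rightarrow> ('k, 'v, 'y) module_scheme \<Rightarrow> ('v \<Rightarrow> 'v) \<Rightarrow> bool" where
  "linear_operator K V f \<longleftrightarrow>
     f \<in> carrier V \<rightarrow> carrier V \<and>
     (\<forall>u\<in>carrier V. \<forall>v\<in>carrier V. f (u \<oplus>\<^bsub>V\<^esub> v) = f u \<oplus>\<^bsub>V\<^esub> f v) \<and>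
     (\<forall>c\<in>carrier K. \<forall>v\<in>carrier V. f (c \<odot>\<^bsub>V\<^esub> v) = c \<odot>\<^bsub>V\<^esub> f v)"

section \<open>Multiple Rota-Baxter algebras of pair weight \<open>(\<lambda>\<^sub>\<Omega>, \<lambda>\<^sub>\<Omega>)\<close> and their modules\<close>

locale multiple_rota_baxter_algebra = assoc_algebra K R
  for K :: "('k, 'x) ring_scheme" and R :: "('k, 'r, 'y) module_scheme"
    and \<Omega> :: "'w set" and wt :: "'w \<Rightarrow> 'k" and P :: "'w \<Rightarrow> 'r \<Rightarrow> 'r" +
  assumes index_nonempty: "\<Omega> \<noteq> {}"
    and weight_closed: "wt \<in> \<Omega> \<rightarrow> carrier K"
    and P_linear: "\<omega> \<in> \<Omega> \<Longrightarrow> linear_operator K R (P \<omega>)"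
    and rota_baxter:
      "\<lbrakk>\<alpha> \<in> \<Omega>; \<beta> \<in> \<Omega>; r \<in> carrier R; s \<in> carrier R\<rbrakk> \<Longrightarrow>
       P \<alpha> r \<otimes>\<^bsub>R\<^esub> P \<beta> s =
         P \<alpha> (r \<otimes>\<^bsub>R\<^esub> P \<beta> s) \<oplus>\<^bsub>R\<^esub> P \<beta> (P \<alpha> r \<otimes>\<^bsub>R\<^esub> s)
         \<oplus>\<^bsub>R\<^esub> wt \<beta> \<odot>\<^bsub>R\<^esub> P \<alpha> (r \<otimes>\<^bsub>R\<^esub> s) \<oplus>\<^bsub>R\<^esub> wt \<alpha> \<odot>\<^bsub>R\<^esub> P \<beta> (r \<otimes>\<^bsub>R\<^esub> s)"

locale left_rota_baxter_module =
  multiple_rota_baxter_algebra K R \<Omega> wt P + N?: left_module R N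
  for K :: "('k, 'x) ring_scheme" and R :: "('k, 'r, 'y) module_scheme"
    and \<Omega> :: "'w set" and wt :: "'w \<Rightarrow> 'k" and P :: "'w \<Rightarrow> 'r \<Rightarrow> 'r"
    and N :: "('r, 'n, 'z) module_scheme" and nop :: "'w \<Rightarrow> 'n \<Rightarrow> 'n" +
  assumes nop_linear: "\<omega> \<in> \<Omega> \<Longrightarrow> linear_operator K (left_scalars R N) (nop \<omega>)"
    and left_rota_baxter:
      "\<lbrakk>\<alpha> \<in> \<Omega>; \<beta> \<in> \<Omega>; r \<in> carrier R; n \<in> carrier N\<rbrakk> \<Longrightarrow>
       P \<alpha> r \<odot>\<^bsub>N\<^esub> nop \<beta> n =
         nop \<alpha> (r \<odot>\<^bsub>N\<^esub> nop \<beta> n) \<oplus>\<^bsub>N\<^esub> nop \<beta> (P \<alpha> r \<odot>\<^bsub>N\<^esub> n)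
         \<oplus>\<^bsub>N\<^esub> wt \<beta> \<odot>\<^bsub>left_scalars R N\<^esub> nop \<alpha> (r \<odot>\<^bsub>N\<^esub> n)
         \<oplus>\<^bsub>N\<^esub> wt \<alpha> \<odot>\<^bsub>left_scalars R N\<^esub> nop \<beta> (r \<odot>\<^bsub>N\<^esub> n)"

locale right_rota_baxter_module =
  multiple_rota_baxter_algebra K R \<Omega> wt P + M?: right_module R M
  for K :: "('k, 'x) ring_scheme" and R :: "('k, 'r, 'y) module_scheme"
    and \<Omega> :: "'w set" and wt :: "'w \<Rightarrow> 'k" and P :: "'w \<Rightarrow> 'r \<Rightarrow> 'r"
    and M :: "('r, 'm, 'z) right_module_rec_scheme" and mop :: "'w \<Rightarrow> 'm \<Rightarrow> 'm" +
  assumes mop_linear: "\<omega> \<in> \<Omega> \<Longrightarrow> linear_operator K (right_scalars R M) (mop \<omega>)"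
    and right_rota_baxter:
      "\<lbrakk>\<alpha> \<in> \<Omega>; \<beta> \<in> \<Omega>; r \<in> carrier R; m \<in> carrier M\<rbrakk> \<Longrightarrow>
       mop \<beta> (m \<bullet>\<^bsub>M\<^esub> P \<alpha> r) =
         mop \<beta> (mop \<alpha> m \<bullet>\<^bsub>M\<^esub> r) \<oplus>\<^bsub>M\<^esub> mop \<beta> m \<bullet>\<^bsub>M\<^esub> P \<alpha> r
         \<oplus>\<^bsub>M\<^esub> wt \<beta> \<odot>\<^bsub>right_scalars R M\<^esub> (mop \<alpha> m \<bullet>\<^bsub>M\<^esub> r)
         \<oplus>\<^bsub>M\<^esub> wt \<alpha> \<odot>\<^bsub>right_scalars R M\<^esub> (mop \<beta> m \<bullet>\<^bsub>M\<^esub> r)"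

section \<open>Tensor products over a multiple Rota-Baxter algebra\<close>

text \<open>Abelian groups \<open>A\<close> are \<^locale>\<open>comm_group\<close>s, hence written multiplicatively.\<close>

definition rb_bilinear ::
  "('r, 'x) ring_scheme \<Rightarrow> 'w set
   \<Rightarrow> ('r, 'm, 'y) right_module_rec_scheme \<Rightarrow> ('w \<Rightarrow> 'm \<Rightarrow> 'm)
   \<Rightarrow> ('r, 'n, 'z) module_scheme \<Rightarrow> ('w \<Rightarrow> 'n \<Rightarrow> 'n)
   \<Rightarrow> ('a, 'v) monoid_scheme \<Rightarrow> ('m \<times> 'n \<Rightarrow> 'a) \<Rightarrow> bool" where
  "rb_bilinear R \<Omega> M mop N nop A \<phi> \<longleftrightarrow>
     \<phi> \<in> carrier M \<times> carrier N \<rightarrow> carrier A \<and>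
     (\<forall>m\<^sub>1\<in>carrier M. \<forall>m\<^sub>2\<in>carrier M. \<forall>n\<in>carrier N.
        \<phi> (m\<^sub>1 \<oplus>\<^bsub>M\<^esub> m\<^sub>2, n) = \<phi> (m\<^sub>1, n) \<otimes>\<^bsub>A\<^esub> \<phi> (m\<^sub>2, n)) \<and>
     (\<forall>m\<in>carrier M. \<forall>n\<^sub>1\<in>carrier N. \<forall>n\<^sub>2\<in>carrier N.
        \<phi> (m, n\<^sub>1 \<oplus>\<^bsub>N\<^esub> n\<^sub>2) = \<phi> (m, n\<^sub>1) \<otimes>\<^bsub>A\<^esub> \<phi> (m, n\<^sub>2)) \<and>
     (\<forall>m\<in>carrier M. \<forall>n\<in>carrier N. \<forall>r\<in>carrier R.
        \<phi> (m \<bullet>\<^bsub>M\<^esub> r, n) = \<phi> (m, r \<odot>\<^bsub>N\<^esub> n)) \<and>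
     (\<forall>m\<in>carrier M. \<forall>n\<in>carrier N. \<forall>\<omega>\<in>\<Omega>.
        \<phi> (mop \<omega> m, n) = \<phi> (m, nop \<omega> n))"

text \<open>
  HOL cannot quantify over all types inside a definition, so the type of the elements of the test
  groups \<open>A\<close> is the parameter \<open>TYPE('a)\<close>; a theorem in which \<open>'a\<close> is a free type variable is
  about all abelian groups. Restricting to \<^term>\<open>extensional (carrier T)\<close> makes \<open>\<exists>!\<close> mean
  uniqueness of \<open>h\<close> on the carrier of \<open>T\<close>, its values elsewhere being irrelevant.
\<close>

definition is_rb_tensor_product ::
  "'a itself \<Rightarrow> ('r, 'x) ring_scheme \<Rightarrow> 'w set
   \<Rightarrow> ('r, 'm, 'y) right_module_rec_scheme \<Rightarrow> ('w \<Rightarrow> 'm \<Rightarrow> 'm)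
   \<Rightarrow> ('r, 'n, 'z) module_scheme \<Rightarrow> ('w \<Rightarrow> 'n \<Rightarrow> 'n)
   \<Rightarrow> ('t, 'v) monoid_scheme \<Rightarrow> ('m \<times> 'n \<Rightarrow> 't) \<Rightarrow> bool" where
  "is_rb_tensor_product (_ :: 'a itself) R \<Omega> M mop N nop T \<zeta> \<longleftrightarrow>
     comm_group T \<and>
     rb_bilinear R \<Omega> M mop N nop T \<zeta> \<and>
     (\<forall>(A :: 'a monoid) \<phi>. comm_group A \<and> rb_bilinear R \<Omega> M mop N nop A \<phi> \<longrightarrow>
        (\<exists>!h. h \<in> hom T A \<inter> extensional (carrier T) \<and>
              (\<forall>x \<in> carrier M \<times> carrier N. \<phi> x = h (\<zeta> x))))"

text \<open>In \<^const>\<open>free_Abelian_group\<close>, the generator \<open>x\<close> is \<^term>\<open>frag_of x\<close>, and the group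
  operation is addition of finitely supported integer-valued functions.\<close>

definition tensor_relations ::
  "('r, 'x) ring_scheme \<Rightarrow> 'w set
   \<Rightarrow> ('r, 'm, 'y) right_module_rec_scheme \<Rightarrow> ('w \<Rightarrow> 'm \<Rightarrow> 'm)
   \<Rightarrow> ('r, 'n, 'z) module_scheme \<Rightarrow> ('w \<Rightarrow> 'n \<Rightarrow> 'n)
   \<Rightarrow> (('m \<times> 'n) \<Rightarrow>\<^sub>0 int) set" where
  "tensor_relations R \<Omega> M mop N nop =
     {frag_of (m\<^sub>1 \<oplus>\<^bsub>M\<^esub> m\<^sub>2, n) - frag_of (m\<^sub>1, n) - frag_of (m\<^sub>2, n) | m\<^sub>1 m\<^sub>2 n.
        m\<^sub>1 \<in> carrier M \<and> m\<^sub>2 \<in> carrier M \<and> n \<in> carrier N} \<union>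
     {frag_of (m, n\<^sub>1 \<oplus>\<^bsub>N\<^esub> n\<^sub>2) - frag_of (m, n\<^sub>1) - frag_of (m, n\<^sub>2) | m n\<^sub>1 n\<^sub>2.
        m \<in> carrier M \<and> n\<^sub>1 \<in> carrier N \<and> n\<^sub>2 \<in> carrier N} \<union>
     {frag_of (m \<bullet>\<^bsub>M\<^esub> r, n) - frag_of (m, r \<odot>\<^bsub>N\<^esub> n) | m r n.
        m \<in> carrier M \<and> r \<in> carrier R \<and> n \<in> carrier N} \<union>
     {frag_of (mop \<omega> m, n) - frag_of (m, nop \<omega> n) | \<omega> m n.
        \<omega> \<in> \<Omega> \<and> m \<in> carrier M \<and> n \<in> carrier N}"

end

theory Submission
  imports Defs
begin

text \<open>
  A homomorphism out of a free abelian group is determined by its values on the generators, and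
  these can be prescribed arbitrarily. Maps \<open>\<phi> : M \<times> N \<rightarrow> A\<close> and homomorphisms \<open>h : G \<rightarrow> A\<close> are
  therefore the same data, and under this correspondence each clause in the definition of an
  \<open>(R, P\<^sub>\<Omega>)\<close>-bilinear map says precisely that \<open>h\<close> kills one of the four families of generators of
  \<open>I\<close>. This equivalence, \<open>rb_bilinear_iff_kills_relations\<close>, carries the proof, and it is used in
  both directions.

  From right to left it is applied to the projection \<open>G \<rightarrow> G/I\<close>, whose kernel contains the relations:
  this makes \<open>\<zeta>\<close> bilinear. From left to right it is applied to the homomorphism \<open>G \<rightarrow> A\<close> that
  extends a given bilinear map \<open>\<phi>\<close>: it kills the relations, hence the subgroup \<open>I\<close> that they
  generate, and so descends to \<open>G/I\<close>. The descended map is unique because the cosets of the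
  generators of \<open>G\<close> generate \<open>G/I\<close>. This last argument does not depend on the shape of the
  relations and is the universal property of an abelian group given by generators and relations,
  \<open>presented_abelian_group_universal\<close>.
\<close>

section \<open>Abelian groups given by generators and relations\<close>

lemma hom_free_Abelian_group_diff:
  assumes "group A" and "h \<in> hom (free_Abelian_group S) A"
    and a: "Poly_Mapping.keys a \<subseteq> S" and b: "Poly_Mapping.keys b \<subseteq> S"
  shows "h (a - b) = h a \<otimes>\<^bsub>A\<^esub> inv\<^bsub>A\<^esub> h b"
proof -
  interpret h: group_hom "free_Abelian_group S" A h
    using assms by (simp add: group_hom_def group_hom_axioms_def)
  have "h (a \<otimes>\<^bsub>free_Abelian_group S\<^esub> inv\<^bsub>free_Abelian_group S\<^esub> b) = h a \<otimes>\<^bsub>A\<^esub> inv\<^bsub>A\<^esub> h b"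
    using a b by (metis carrier_free_Abelian_group_iff group.inv_closed group_free_Abelian_group
        h.hom_inv h.hom_mult)
  then show ?thesis
    using b by simp
qed

lemma hom_free_Abelian_group_diff_eq_one_iff:
  assumes "group A" and h: "h \<in> hom (free_Abelian_group S) A"
    and a: "Poly_Mapping.keys a \<subseteq> S" and b: "Poly_Mapping.keys b \<subseteq> S"
  shows "h (a - b) = \<one>\<^bsub>A\<^esub> \<longleftrightarrow> h a = h b"
proof -
  interpret A: group A by fact
  have c: "h a \<in> carrier A" "h b \<in> carrier A"
    using a b hom_in_carrier[OF h] by auto
  then have "h a \<otimes>\<^bsub>A\<^esub> inv\<^bsub>A\<^esub> h b = \<one>\<^bsub>A\<^esub> \<longleftrightarrow> h a = h b"
    by (metis A.inv_closed A.inv_equality A.inv_inv A.r_inv)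
  then show ?thesis
    by (simp add: hom_free_Abelian_group_diff[OF assms])
qed

lemma hom_free_Abelian_group_diff2_eq_one_iff:
  assumes "group A" and h: "h \<in> hom (free_Abelian_group S) A"
    and a: "Poly_Mapping.keys a \<subseteq> S" and b: "Poly_Mapping.keys b \<subseteq> S"
    and c: "Poly_Mapping.keys c \<subseteq> S"
  shows "h (a - b - c) = \<one>\<^bsub>A\<^esub> \<longleftrightarrow> h a = h b \<otimes>\<^bsub>A\<^esub> h c"
proof -
  have bc: "Poly_Mapping.keys (b + c) \<subseteq> S"
    using b c keys_add[of b c] by blast
  have "h (b + c) = h b \<otimes>\<^bsub>A\<^esub> h c"
    using hom_mult[OF h, of b c] b c by simp
  then show ?thesis
    using hom_free_Abelian_group_diff_eq_one_iff[OF assms(1) h a bc] by (simp add: diff_diff_eq)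
qed

lemma hom_free_Abelian_group_eqI:
  assumes "group A" and g: "g \<in> hom (free_Abelian_group S) A"
    and h: "h \<in> hom (free_Abelian_group S) A"
    and eq: "\<And>x. x \<in> S \<Longrightarrow> g (frag_of x) = h (frag_of x)"
    and c: "Poly_Mapping.keys c \<subseteq> S"
  shows "g c = h c"
proof (rule free_Abelian_group_induct[OF c])
  show "g 0 = h 0"
    using hom_one[OF g] hom_one[OF h] \<open>group A\<close> by simp
next
  fix x y
  assume "Poly_Mapping.keys x \<subseteq> S" "Poly_Mapping.keys y \<subseteq> S" "g x = h x" "g y = h y"
  then show "g (x - y) = h (x - y)"
    by (simp add: hom_free_Abelian_group_diff[OF \<open>group A\<close> g]
        hom_free_Abelian_group_diff[OF \<open>group A\<close> h])
qed (rule eq)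

text \<open>
  Existence is the universal property of the free group followed by that of the quotient. For
  uniqueness, two candidates are pulled back along the surjection onto the quotient and compared
  on the generators. That \<open>f\<close> respects the relations is expressed through the homomorphisms \<open>h\<close>
  extending \<open>f\<close>; there is exactly one on \<open>F\<close>, so quantifying over them avoids naming it.
\<close>

lemma presented_abelian_group_universal:
  fixes S :: "'s set" and Rel :: "('s \<Rightarrow>\<^sub>0 int) set"
  defines "F \<equiv> free_Abelian_group S"
  defines "I \<equiv> generate F Rel"
  assumes "comm_group A" and Rel: "Rel \<subseteq> carrier F"
    and f: "f \<in> S \<rightarrow> carrier A"
    and kills: "\<And>h. \<lbrakk>h \<in> hom F A; \<And>x. x \<in> S \<Longrightarrow> h (frag_of x) = f x\<rbrakk> \<Longrightarrow> Rel \<subseteq> kernel F A h"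
  shows "\<exists>!g. g \<in> hom (F Mod I) A \<inter> extensional (carrier (F Mod I)) \<and>
              (\<forall>x\<in>S. f x = g (I #>\<^bsub>F\<^esub> frag_of x))"
proof -
  interpret A: comm_group A by fact
  interpret F: comm_group F
    unfolding F_def by (rule abelian_free_Abelian_group)
  have "I \<lhd> F"
    using F.generate_is_subgroup[OF Rel] F.subgroup_imp_normal by (simp add: I_def)
  then interpret I: normal I F .
  obtain h where h: "h \<in> hom F A" "\<And>x. x \<in> S \<Longrightarrow> h (frag_of x) = f x"
    using A.free_Abelian_group_universal[of f S] f unfolding F_def by blast
  interpret h: group_hom F A h
    using h(1) by unfold_locales
  have "I \<subseteq> kernel F A h"
    unfolding I_def by (rule F.generate_subgroup_incl[OF kills[OF h] h.subgroup_kernel])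
  then obtain g where g: "g \<in> hom (F Mod I) A" "\<And>c. c \<in> carrier F \<Longrightarrow> g (I #>\<^bsub>F\<^esub> c) = h c"
    using h.FactGroup_universal_kernel[OF \<open>I \<lhd> F\<close>] by blast
  interpret Q: group "F Mod I"
    by (rule I.factorgroup_is_group)
  have frag_of_in: "frag_of x \<in> carrier F" if "x \<in> S" for x
    using that by (simp add: F_def)
  show ?thesis
  proof (rule ex1I)
    have "restrict g (carrier (F Mod I)) \<in> hom (F Mod I) A"
      using g(1) by (rule Q.hom_restrict) simp
    moreover have "f x = restrict g (carrier (F Mod I)) (I #>\<^bsub>F\<^esub> frag_of x)" if "x \<in> S" for x
      using frag_of_in[OF that] by (simp add: carrier_FactGroup g(2) h(2) that)
    ultimately show "restrict g (carrier (F Mod I)) \<in> hom (F Mod I) A \<inter> extensional (carrier (F Mod I)) \<and>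
        (\<forall>x\<in>S. f x = restrict g (carrier (F Mod I)) (I #>\<^bsub>F\<^esub> frag_of x))"
      by simp
  next
    fix g'
    assume g': "g' \<in> hom (F Mod I) A \<inter> extensional (carrier (F Mod I)) \<and>
        (\<forall>x\<in>S. f x = g' (I #>\<^bsub>F\<^esub> frag_of x))"
    have pullback: "g' \<circ> (\<lambda>c. I #>\<^bsub>F\<^esub> c) \<in> hom (free_Abelian_group S) A"
      using hom_compose[OF I.r_coset_hom_Mod] g' by (auto simp flip: F_def)
    have "g' (I #>\<^bsub>F\<^esub> c) = h c" if "c \<in> carrier F" for c
      using hom_free_Abelian_group_eqI[OF A.is_group pullback h(1)[unfolded F_def], of c] g' h(2) that
      by (simp add: F_def)
    then have "g' u = restrict g (carrier (F Mod I)) u" if "u \<in> carrier (F Mod I)" for u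
      using that by (auto simp: carrier_FactGroup g(2))
    then show "g' = restrict g (carrier (F Mod I))"
      using g' by (intro extensionalityI[of _ "carrier (F Mod I)"]) auto
  qed
qed

section \<open>Bilinear maps as homomorphisms killing the relations\<close>

lemma linear_operator_closed:
  "\<lbrakk>linear_operator K V f; v \<in> carrier V\<rbrakk> \<Longrightarrow> f v \<in> carrier V"
  by (auto simp: linear_operator_def)

lemma (in right_rota_baxter_module) mop_closed:
  "\<lbrakk>\<omega> \<in> \<Omega>; m \<in> carrier M\<rbrakk> \<Longrightarrow> mop \<omega> m \<in> carrier M"
  using linear_operator_closed[OF mop_linear] by (simp add: right_scalars_def)

lemma (in left_rota_baxter_module) nop_closed:
  "\<lbrakk>\<omega> \<in> \<Omega>; n \<in> carrier N\<rbrakk> \<Longrightarrow> nop \<omega> n \<in> carrier N"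
  using linear_operator_closed[OF nop_linear] by (simp add: left_scalars_def)

lemma tensor_relations_closed:
  assumes "right_rota_baxter_module K R \<Omega> wt P M mop"
    and "left_rota_baxter_module K R \<Omega> wt P N nop"
  shows "tensor_relations R \<Omega> M mop N nop \<subseteq> carrier (free_Abelian_group (carrier M \<times> carrier N))"
proof -
  interpret M: right_rota_baxter_module K R \<Omega> wt P M mop by fact
  interpret N: left_rota_baxter_module K R \<Omega> wt P N nop by fact
  let ?F = "free_Abelian_group (carrier M \<times> carrier N)"
  have diff: "a - b \<in> carrier ?F" if "a \<in> carrier ?F" "b \<in> carrier ?F" for a b
    using that keys_diff[of a b] by auto
  show ?thesis
    unfolding tensor_relations_def
    by (auto intro!: diff simp: M.mop_closed N.nop_closed M.M.rsmult_closed N.N.lsmult_closed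
        simp del: carrier_free_Abelian_group_iff)
qed

text \<open>
  A homomorphism kills \<open>a - b\<close> iff it agrees on \<open>a\<close> and \<open>b\<close>, and it kills \<open>a - b - c\<close> iff its
  value at \<open>a\<close> is the product of those at \<open>b\<close> and \<open>c\<close>. Applied to the four families of
  relations, this turns each of them into the corresponding clause of bilinearity.
\<close>

lemma rb_bilinear_iff_kills_relations:
  assumes M: "right_rota_baxter_module K R \<Omega> wt P M mop"
    and N: "left_rota_baxter_module K R \<Omega> wt P N nop"
    and A: "group A"
    and h: "h \<in> hom (free_Abelian_group (carrier M \<times> carrier N)) A"
    and \<phi>: "\<And>x. x \<in> carrier M \<times> carrier N \<Longrightarrow> h (frag_of x) = \<phi> x"
  shows "rb_bilinear R \<Omega> M mop N nop A \<phi> \<longleftrightarrow>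
         tensor_relations R \<Omega> M mop N nop \<subseteq> kernel (free_Abelian_group (carrier M \<times> carrier N)) A h"
proof -
  interpret M: right_rota_baxter_module K R \<Omega> wt P M mop by fact
  interpret N: left_rota_baxter_module K R \<Omega> wt P N nop by fact
  let ?F = "free_Abelian_group (carrier M \<times> carrier N)"
  note closed = M.mop_closed N.nop_closed M.M.rsmult_closed N.N.lsmult_closed
  have \<phi>_closed: "\<phi> \<in> carrier M \<times> carrier N \<rightarrow> carrier A"
  proof
    fix x assume "x \<in> carrier M \<times> carrier N"
    then show "\<phi> x \<in> carrier A"
      using hom_in_carrier[OF h, of "frag_of x"] \<phi>[of x] by simp
  qed
  have two: "h (frag_of x - frag_of y) = \<one>\<^bsub>A\<^esub> \<longleftrightarrow> \<phi> x = \<phi> y"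
    if "x \<in> carrier M \<times> carrier N" "y \<in> carrier M \<times> carrier N" for x y
    using hom_free_Abelian_group_diff_eq_one_iff[OF A h, of "frag_of x" "frag_of y"] that
    by (simp add: \<phi>)
  have three: "h (frag_of x - frag_of y - frag_of z) = \<one>\<^bsub>A\<^esub> \<longleftrightarrow> \<phi> x = \<phi> y \<otimes>\<^bsub>A\<^esub> \<phi> z"
    if "x \<in> carrier M \<times> carrier N" "y \<in> carrier M \<times> carrier N" "z \<in> carrier M \<times> carrier N" for x y z
    using hom_free_Abelian_group_diff2_eq_one_iff[OF A h, of "frag_of x" "frag_of y" "frag_of z"] that
    by (simp add: \<phi>)
  have "tensor_relations R \<Omega> M mop N nop \<subseteq> kernel ?F A h \<longleftrightarrow>
        (\<forall>c\<in>tensor_relations R \<Omega> M mop N nop. h c = \<one>\<^bsub>A\<^esub>)"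
    using tensor_relations_closed[OF M N] unfolding kernel_def by blast
  also have "\<dots> \<longleftrightarrow>
     (\<forall>m\<^sub>1\<in>carrier M. \<forall>m\<^sub>2\<in>carrier M. \<forall>n\<in>carrier N.
        h (frag_of (m\<^sub>1 \<oplus>\<^bsub>M\<^esub> m\<^sub>2, n) - frag_of (m\<^sub>1, n) - frag_of (m\<^sub>2, n)) = \<one>\<^bsub>A\<^esub>) \<and>
     (\<forall>m\<in>carrier M. \<forall>n\<^sub>1\<in>carrier N. \<forall>n\<^sub>2\<in>carrier N.
        h (frag_of (m, n\<^sub>1 \<oplus>\<^bsub>N\<^esub> n\<^sub>2) - frag_of (m, n\<^sub>1) - frag_of (m, n\<^sub>2)) = \<one>\<^bsub>A\<^esub>) \<and>
     (\<forall>m\<in>carrier M. \<forall>n\<in>carrier N. \<forall>r\<in>carrier R.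
        h (frag_of (m \<bullet>\<^bsub>M\<^esub> r, n) - frag_of (m, r \<odot>\<^bsub>N\<^esub> n)) = \<one>\<^bsub>A\<^esub>) \<and>
     (\<forall>m\<in>carrier M. \<forall>n\<in>carrier N. \<forall>\<omega>\<in>\<Omega>.
        h (frag_of (mop \<omega> m, n) - frag_of (m, nop \<omega> n)) = \<one>\<^bsub>A\<^esub>)"
    unfolding tensor_relations_def by blast
  also have "\<dots> \<longleftrightarrow> rb_bilinear R \<Omega> M mop N nop A \<phi>"
    unfolding rb_bilinear_def using \<phi>_closed by (simp add: two three closed cong: ball_cong)
  finally show ?thesis by simp
qed

section \<open>The tensor product as a quotient of the free abelian group\<close>

theorem theorem4p2:
  fixes K :: "('k, 'x) ring_scheme"
    and R :: "('k, 'r, 'y) module_scheme"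
    and \<Omega> :: "'w set" and wt :: "'w \<Rightarrow> 'k" and P :: "'w \<Rightarrow> 'r \<Rightarrow> 'r"
    and M :: "('r, 'm, 'u) right_module_rec_scheme" and mop :: "'w \<Rightarrow> 'm \<Rightarrow> 'm"
    and N :: "('r, 'n, 'v) module_scheme" and nop :: "'w \<Rightarrow> 'n \<Rightarrow> 'n"
    and G :: "(('m \<times> 'n) \<Rightarrow>\<^sub>0 int) monoid"
    and I :: "(('m \<times> 'n) \<Rightarrow>\<^sub>0 int) set"
  assumes "multiple_rota_baxter_algebra K R \<Omega> wt P"
    and "right_rota_baxter_module K R \<Omega> wt P M mop"
    and "left_rota_baxter_module K R \<Omega> wt P N nop"
  defines "G \<equiv> free_Abelian_group (carrier M \<times> carrier N)"
    and "I \<equiv> generate G (tensor_relations R \<Omega> M mop N nop)"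
  shows "is_rb_tensor_product TYPE('a) R \<Omega> M mop N nop
           (G Mod I) (\<lambda>x. I #>\<^bsub>G\<^esub> frag_of x)"
proof -
  note M = assms(2) and N = assms(3)
  note Rel = tensor_relations_closed[OF M N, folded G_def]
  interpret G: comm_group G
    unfolding G_def by (rule abelian_free_Abelian_group)
  have "subgroup I G"
    unfolding I_def by (rule G.generate_is_subgroup[OF Rel])
  then have "I \<lhd> G"
    by (rule G.subgroup_imp_normal)
  then interpret I: normal I G .
  have "rb_bilinear R \<Omega> M mop N nop (G Mod I) (\<lambda>x. I #>\<^bsub>G\<^esub> frag_of x)"
  proof (subst rb_bilinear_iff_kills_relations[OF M N I.factorgroup_is_group, folded G_def])
    show "(\<lambda>c. I #>\<^bsub>G\<^esub> c) \<in> hom G (G Mod I)"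
      by (rule I.r_coset_hom_Mod)
    have "tensor_relations R \<Omega> M mop N nop \<subseteq> I"
      unfolding I_def by (auto intro: generate.incl)
    then show "tensor_relations R \<Omega> M mop N nop \<subseteq> kernel G (G Mod I) (\<lambda>c. I #>\<^bsub>G\<^esub> c)"
      using Rel G.coset_join2 \<open>subgroup I G\<close> by (auto simp: kernel_def)
  qed simp
  moreover have "\<exists>!h. h \<in> hom (G Mod I) A \<inter> extensional (carrier (G Mod I)) \<and>
      (\<forall>x\<in>carrier M \<times> carrier N. \<phi> x = h (I #>\<^bsub>G\<^esub> frag_of x))"
    if "comm_group A" and \<phi>: "rb_bilinear R \<Omega> M mop N nop A \<phi>" for A :: "'a monoid" and \<phi>
    unfolding I_def G_def
  proof (rule presented_abelian_group_universal[OF \<open>comm_group A\<close>])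
    show "\<phi> \<in> carrier M \<times> carrier N \<rightarrow> carrier A"
      using \<phi> by (simp add: rb_bilinear_def)
  qed (use Rel \<phi> rb_bilinear_iff_kills_relations[OF M N comm_group.axioms(2)[OF \<open>comm_group A\<close>]]
        in \<open>simp_all add: G_def\<close>)
  ultimately show ?thesis
    using G.abelian_FactGroup[OF \<open>subgroup I G\<close>] by (simp add: is_rb_tensor_product_def)
qed

end
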